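(* Let $\mathbf c=(c_j)_{j\ge1}$ be a sequence of non-negative integers and let $k$ be a positive integer. Then $S_{\mathbf c}(n)\equiv 0\pmod k$ for every integer $n\ge 1$ if and only if $k\mid j\,c_j$ for all $j\ge 1$.
   Context: For a sequence $\mathbf c=(c_j)_{j\ge1}$ of non-negative integers, a colour partition of $n$ of type $\mathcal P_{\mathbf c}$ is a partition of $n$ in which each part of size $j$ may appear in any of $c_j$ different colours (no part of size $j$ is allowed if $c_j=0$); formally, it is a finite multiset of pairs $(j,i)$ with $j\ge1$, $1\le i\le c_j$, whose first components sum to $n$. $S_{\mathbf c}(n)$ is the sum of all odd parts minus the sum of all even parts, taken over all colour partitions of $n$ of type $\mathcal P_{\mathbf c}$ (parts counted with multiplicity). *)

theory Defs
  imports "HOL-Library.Multiset" "HOL-Number_Theory.Cong"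
begin

text \<open>
  The sequence \<open>(c\<^sub>j)\<^sub>j\<^sub>\<ge>\<^sub>1\<close> is a function on \<^typ>\<open>nat\<close> whose value at \<open>0\<close> is never used.
  A pair \<open>(j, i)\<close> is a part of size \<open>j\<close> in colour \<open>i\<close>.
\<close>

definition colour_partitions :: "(nat \<Rightarrow> nat) \<Rightarrow> nat \<Rightarrow> (nat \<times> nat) multiset set" where
  "colour_partitions c n =
     {p. (\<forall>(j, i) \<in> set_mset p. 1 \<le> j \<and> 1 \<le> i \<and> i \<le> c j) \<and> (\<Sum>(j, i)\<in>#p. j) = n}"

definition S_colour :: "(nat \<Rightarrow> nat) \<Rightarrow> nat \<Rightarrow> int" where
  "S_colour c n =
     (\<Sum>p\<in>colour_partitions c n.
        (\<Sum>(j, i)\<in>#{#(j, i) \<in># p. odd j#}. int j) - (\<Sum>(j, i)\<in>#{#(j, i) \<in># p. even j#}. int j))"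

text \<open>The outer sum in \<open>S_colour\<close> ranges over a finite set, so it is not the default value \<open>0\<close>.\<close>

lemma finite_colour_partitions: "finite (colour_partitions c n)"
proof -
  let ?A = "SIGMA j:{1..n}. {1..c j}"
  have "colour_partitions c n \<subseteq> (\<Union>m\<le>n. multisets_of_size ?A m)"
  proof
    fix p assume p: "p \<in> colour_partitions c n"
    then have n: "(\<Sum>(j, i)\<in>#p. j) = n"
      and parts: "\<And>j i. (j, i) \<in># p \<Longrightarrow> 1 \<le> j \<and> 1 \<le> i \<and> i \<le> c j"
      by (auto simp: colour_partitions_def)
    have "j \<le> n" if "(j, i) \<in># p" for j i
      using multi_member_split[OF that] n by auto
    with parts have "set_mset p \<subseteq> ?A" by fastforce
    moreover have "size p \<le> (\<Sum>(j, i)\<in>#p. j)"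
      using parts by (induction p) (fastforce+)
    ultimately show "p \<in> (\<Union>m\<le>n. multisets_of_size ?A m)"
      using n by (auto simp: multisets_of_size_def)
  qed
  moreover have "finite (\<Union>m\<le>n. multisets_of_size ?A m)"
    by (intro finite_UN_I finite_multisets_of_size finite_SigmaI) auto
  ultimately show ?thesis by (rule finite_subset)
qed

end

theory Submission
  imports Defs "HOL-Combinatorics.Transposition"
begin

text \<open>
  By the symmetry between the colours of a fixed part size \<open>j\<close>, the total number \<open>t n j\<close> of
  occurrences of the part \<open>(j, i)\<close> in all colour partitions of \<open>n\<close> does not depend on \<open>i\<close>. Hence
  \<open>S n = (\<Sum>j=1..n. \<plusminus> j * c j * t n j)\<close>, which settles one direction. Since \<open>t n n = 1\<close> whenever
  \<open>c n > 0\<close>, the system is triangular in the numbers \<open>j * c j\<close>, which settles the other one.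
\<close>

definition signed_part :: "nat \<Rightarrow> int" where
  "signed_part j = (if odd j then int j else - int j)"

definition occurrences :: "(nat \<Rightarrow> nat) \<Rightarrow> nat \<Rightarrow> nat \<times> nat \<Rightarrow> int" where
  "occurrences c n x = (\<Sum>p\<in>colour_partitions c n. int (count p x))"

text \<open>Indexing by a set \<open>A\<close> that does not depend on \<open>p\<close> is what
  later allows the sum over parts to be exchanged with the sum over partitions.\<close>

lemma sum_mset_eq_sum_count:
  fixes f :: "'a \<Rightarrow> 'b::comm_semiring_1"
  assumes "finite A" "set_mset p \<subseteq> A"
  shows "(\<Sum>x\<in>#p. f x) = (\<Sum>x\<in>A. of_nat (count p x) * f x)"
  using assms(2)
proof (induction p)
  case (add y p)
  have "(\<Sum>x\<in>A. of_nat (count (add_mset y p) x) * f x)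
      = (\<Sum>x\<in>A. (if x = y then f x else 0) + of_nat (count p x) * f x)"
    by (intro sum.cong) (auto simp: algebra_simps)
  then show ?case
    using add assms(1) by (simp add: sum.distrib)
qed simp

lemma odd_minus_even_parts:
  "(\<Sum>(j, i)\<in>#{#(j, i) \<in># p. odd j#}. int j) - (\<Sum>(j, i)\<in>#{#(j, i) \<in># p. even j#}. int j)
    = (\<Sum>x\<in>#p. signed_part (fst x))"
  by (induction p) (auto simp: signed_part_def)

lemma set_mset_colour_partition:
  assumes "p \<in> colour_partitions c n"
  shows "set_mset p \<subseteq> (SIGMA j:{1..n}. {1..c j})"
proof
  fix x assume x: "x \<in># p"
  obtain j i where [simp]: "x = (j, i)" by fastforce
  from assms have "(\<Sum>(j, i)\<in>#p. j) = n" by (simp add: colour_partitions_def)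
  moreover obtain q where "p = add_mset (j, i) q"
    using multi_member_split[OF x] by auto
  ultimately show "x \<in> (SIGMA j:{1..n}. {1..c j})"
    using assms by (auto simp: colour_partitions_def)
qed

lemma S_colour_eq_sum_occurrences:
  "S_colour c n = (\<Sum>j=1..n. \<Sum>i=1..c j. signed_part j * occurrences c n (j, i))"
proof -
  let ?A = "SIGMA j:{1..n}. {1..c j}"
  have "S_colour c n = (\<Sum>p\<in>colour_partitions c n. \<Sum>x\<in>?A. int (count p x) * signed_part (fst x))"
    unfolding S_colour_def odd_minus_even_parts
    by (intro sum.cong refl sum_mset_eq_sum_count set_mset_colour_partition) auto
  also have "\<dots> = (\<Sum>x\<in>?A. signed_part (fst x) * occurrences c n x)"
    unfolding occurrences_def
    by (subst sum.swap) (simp add: sum_distrib_left mult.commute)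
  also have "\<dots> = (\<Sum>j=1..n. \<Sum>i=1..c j. signed_part j * occurrences c n (j, i))"
    by (subst sum.Sigma) (auto intro!: sum.cong)
  finally show ?thesis .
qed

text \<open>Swapping the colours \<open>i\<close> and \<open>i'\<close> on parts of size
  \<open>j\<close> keeps every part size and maps admissible colours to admissible ones. It is
  therefore an involution on the colour partitions of \<open>n\<close>, and it carries the
  multiplicity of \<open>(j, i)\<close> to that of \<open>(j, i')\<close>.\<close>

lemma occurrences_colour_invariant:
  assumes "i \<in> {1..c j}" "i' \<in> {1..c j}"
  shows "occurrences c n (j, i) = occurrences c n (j, i')"
proof -
  let ?t = "transpose (j, i) (j, i')"
  have sizes: "fst (?t x) = fst x" for x
    by (auto simp: transpose_def)
  have colours: "1 \<le> snd (?t x) \<and> snd (?t x) \<le> c (fst x)"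
    if "1 \<le> snd x \<and> snd x \<le> c (fst x)" for x
    using that assms by (auto simp: transpose_def)
  have closed: "image_mset ?t p \<in> colour_partitions c n" if "p \<in> colour_partitions c n" for p
    using that sizes colours
    by (auto simp: colour_partitions_def case_prod_unfold multiset.map_comp comp_def)
  have involution: "image_mset ?t (image_mset ?t p) = p" for p
    by (simp add: multiset.map_comp)
  have "?t x = (j, i') \<longleftrightarrow> x = (j, i)" for x
    by (auto simp: transpose_def)
  then have count: "count (image_mset ?t p) (j, i') = count p (j, i)" for p
    by (induction p) auto
  show ?thesis
    unfolding occurrences_def
    by (rule sum.reindex_bij_witness[where i = "image_mset ?t" and j = "image_mset ?t"])
       (auto simp: closed involution count)
qed

lemma S_colour_eq:
  "S_colour c n = (\<Sum>j=1..n. signed_part j * int (c j) * occurrences c n (j, 1))"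
  unfolding S_colour_eq_sum_occurrences
proof (intro sum.cong refl)
  fix j
  have "(\<Sum>i=1..c j. signed_part j * occurrences c n (j, i))
      = (\<Sum>i=1..c j. signed_part j * occurrences c n (j, 1))"
    \<comment> \<open>Colour 1 is admissible as soon as the index range is inhabited; for
      \<open>c j = 0\<close> both sums are empty.\<close>
    by (intro sum.cong refl arg_cong2[where f = "(*)"] occurrences_colour_invariant) auto
  then show "(\<Sum>i=1..c j. signed_part j * occurrences c n (j, i))
      = signed_part j * int (c j) * occurrences c n (j, 1)"
    by simp
qed

text \<open>A part of size \<open>n\<close> exhausts the whole sum, so a partition containing
  \<open>(n, 1)\<close> has no room for another part.\<close>

lemma occurrences_largest_part:
  assumes "n \<ge> 1" "c n \<ge> 1"
  shows "occurrences c n (n, 1) = 1"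
proof -
  have only: "p = {#(n, 1)#}" if p: "p \<in> colour_partitions c n" and "(n, 1) \<in># p" for p
  proof -
    obtain q where q: "p = add_mset (n, 1) q"
      using multi_member_split[OF \<open>(n, 1) \<in># p\<close>] by auto
    with p have "(\<Sum>(j, i)\<in>#q. j) = 0" "\<forall>(j, i)\<in>#q. 1 \<le> j"
      by (auto simp: colour_partitions_def)
    then have "q = {#}"
      by (cases q) auto
    with q show ?thesis by simp
  qed
  have "int (count p (n, 1)) = (if p = {#(n, 1)#} then 1 else 0)"
    if p: "p \<in> colour_partitions c n" for p
  proof (cases "(n, 1) \<in># p")
    case True
    then show ?thesis using only[OF p] by simp
  next
    case False
    then show ?thesis by (auto simp: not_in_iff)
  qed
  then have "occurrences c n (n, 1)
      = (\<Sum>p\<in>colour_partitions c n. if p = {#(n, 1)#} then 1 else 0)"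
    unfolding occurrences_def by (intro sum.cong) auto
  moreover have "{#(n, 1)#} \<in> colour_partitions c n"
    using assms by (simp add: colour_partitions_def)
  ultimately show ?thesis
    by (simp add: finite_colour_partitions)
qed

text \<open>The sign is a unit, so divisibility does not see it.\<close>

lemma dvd_signed_part_iff:
  "int k dvd signed_part j * int m \<longleftrightarrow> k dvd j * m"
  by (simp add: signed_part_def flip: of_nat_mult)

theorem theorem5p2:
  fixes c :: "nat \<Rightarrow> nat" and k :: nat
  assumes "k \<ge> 1"
  shows "(\<forall>n\<ge>1. [S_colour c n = 0] (mod int k)) \<longleftrightarrow> (\<forall>j\<ge>1. k dvd j * c j)"
proof
  assume S: "\<forall>n\<ge>1. [S_colour c n = 0] (mod int k)"
  have "k dvd n * c n" if "n \<ge> 1" for n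
    using that
  proof (induction n rule: less_induct)
    case (less n)
    let ?a = "\<lambda>j. signed_part j * int (c j) * occurrences c n (j, 1)"
    \<comment> \<open>The induction hypothesis disposes of all terms below \<open>n\<close>. The
      instantiation of \<open>dvd_mult2\<close> splits each term after
      \<open>signed_part j * int (c j)\<close>, the factor known to be divisible.\<close>
    have "int k dvd (\<Sum>j=1..<n. ?a j)"
      using less.IH by (intro dvd_sum dvd_mult2[of _ "_ * int _"])
        (simp add: dvd_signed_part_iff)
    moreover have "S_colour c n = (\<Sum>j=1..<n. ?a j) + ?a n"
    proof -
      have "{1..n} = insert n {1..<n}" using less.prems by auto
      then show ?thesis by (simp add: S_colour_eq)
    qed
    moreover have "int k dvd S_colour c n"
      using S less.prems by (simp add: cong_0_iff)
    ultimately have "int k dvd ?a n"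
      by (simp only: dvd_add_right_iff)
    \<comment> \<open>The diagonal coefficient is 1 if \<open>c n > 0\<close>; otherwise both sides
      vanish.\<close>
    moreover have "?a n = signed_part n * int (c n)"
      using occurrences_largest_part[of n c] less.prems by (cases "c n") auto
    ultimately show ?case
      by (simp only: dvd_signed_part_iff)
  qed
  then show "\<forall>j\<ge>1. k dvd j * c j" by blast
next
  assume "\<forall>j\<ge>1. k dvd j * c j"
  then show "\<forall>n\<ge>1. [S_colour c n = 0] (mod int k)"
    \<comment> \<open>Every summand is a multiple of \<open>signed_part j * int (c j)\<close>,
      whatever the occurrence counts are.\<close>
    unfolding cong_0_iff S_colour_eq
    by (intro allI impI dvd_sum dvd_mult2[of _ "_ * int _"]) (simp add: dvd_signed_part_iff)
qed

end
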